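(* Let $\mathcal{O}\subseteq\mathbb{R}^d$ be a possibly unbounded open subset. Let $Au=-\operatorname{tr}(aD^2u)-\langle b,Du\rangle+cu$, with coefficients defined everywhere on $\underline{\mathcal{O}}$. Suppose that $\partial_0\mathcal{O}$ is $C^{1,\alpha}$ for some $\alpha\in(0,1)$, that $b^\perp\ge 0$ on $\partial_0\mathcal{O}$, that $c\ge c_0$ on $\mathcal{O}$ for some positive constant $c_0$, and that $c>0$ on $\partial_0\mathcal{O}$. Suppose in addition that there is a positive constant $K$ such that $$\operatorname{tr}a(x)+\langle b(x),x\rangle\le K(1+|x|^2),\quad\forall\,x\in\underline{\mathcal{O}}.$$ If $u\in C^2_s(\underline{\mathcal{O}})$ obeys $\sup_{\mathcal{O}}u<\infty$ and $u^*\le 0$ on $\partial\mathcal{O}\setminus\partial_0\mathcal{O}$ (when non-empty), then $$\sup_{\mathcal{O}}u\le 0\vee\frac{1}{c_0}\sup_{\mathcal{O}}Au.$$ Moreover, $A$ has the weak maximum principle property on $\underline{\mathcal{O}}=\mathcal{O}\cup\partial_0\mathcal{O}$ (that is, with $\Sigma=\partial_0\mathcal{O}$) for the convex cone $\mathfrak{K}=\{u\in C^2_s(\underline{\mathcal{O}}):\sup_{\mathcal{O}}u<\infty\}$.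
   Context: $a:\mathcal{O}\to\mathscr{S}^+(d)$ takes values in the non-negative definite symmetric real $d\times d$ matrices; $b$ is $\mathbb{R}^d$-valued and $c$ is real-valued. $x\vee y=\max\{x,y\}$. Degenerate boundary: $\partial_0\mathcal{O}:=\operatorname{int}\{x\in\partial\mathcal{O}:\lim_{\mathcal{O}\ni x'\to x}a(x')=0\}$ (interior relative to $\partial\mathcal{O}$), and $\underline{\mathcal{O}}:=\mathcal{O}\cup\partial_0\mathcal{O}$. The matrix $a$ is extended by $0$ to $\partial_0\mathcal{O}$. $\vec n$ is the inward-pointing unit normal vector field along $\partial_0\mathcal{O}$ and $b^\perp:=\langle b,\vec n\rangle$. $C^2_s(\underline{\mathcal{O}})$ is the set of $u\in C^2(\mathcal{O})\cap C^1(\underline{\mathcal{O}})$ such that $\operatorname{tr}(aD^2u)$ extends to a continuous function on $\underline{\mathcal{O}}$ and this extension is $0$ on $\partial_0\mathcal{O}$. (Here $C^1(\underline{\mathcal O})$ is understood locally: no uniform boundedness is required.) For $u:\mathcal{O}\to\mathbb{R}$, $u^*:\bar{\mathcal{O}}\to[-\infty,\infty]$ is its upper semicontinuous envelope on $\bar{\mathcal{O}}$. Weak maximum principle property: for a relatively open $\Sigma\subseteq\partial\mathcal{O}$ and a convex cone $\mathfrak{K}\subset C^2(\mathcal{O})$, $A$ obeys the weak maximum principle property on $\mathcal{O}\cup\Sigma$ for $\mathfrak{K}$ if whenever $u\in\mathfrak{K}$ obeys $Au\le 0$ on $\mathcal{O}$ and $u^*\le 0$ on $\partial\mathcal{O}\setminus\bar\Sigma$,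 then $u\le 0$ on $\mathcal{O}$.
   Formalization: Repaired: b is assumed to extend continuously from O to its values on ∂₀O, and in the weak maximum principle the cone also requires u* ≤ 0 on closure(∂₀O) \ ∂₀O; without either, the claim is false. *)

theory Defs
  imports "HOL-Analysis.Analysis"
begin

subsection \<open>Coefficients and the degenerate boundary\<close>

definition sym_nonneg :: "real^'n^'n \<Rightarrow> bool" where
  "sym_nonneg M \<longleftrightarrow> transpose M = M \<and> (\<forall>v. 0 \<le> v \<bullet> (M *v v))"

definition deg_boundary :: "(real^'n) set \<Rightarrow> (real^'n \<Rightarrow> real^'n^'n) \<Rightarrow> (real^'n) set" where
  "deg_boundary U a =
     (top_of_set (frontier U)) interior_of {x \<in> frontier U. (a \<longlongrightarrow> 0) (at x within U)}"

definition with_deg_boundary :: "(real^'n) set \<Rightarrow> (real^'n \<Rightarrow> real^'n^'n) \<Rightarrow> (real^'n) set" where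
  "with_deg_boundary U a = U \<union> deg_boundary U a"

subsection \<open>Boundary portions of class \<open>C\<^sup>1\<^sup>,\<^sup>\<alpha>\<close> and the inward normal\<close>

definition C1_holder_on :: "real \<Rightarrow> (real^'n \<Rightarrow> real) \<Rightarrow> (real^'n) set \<Rightarrow> bool" where
  "C1_holder_on \<alpha> f S \<longleftrightarrow>
     (\<exists>G L. (\<forall>x\<in>S. (f has_derivative (\<lambda>h. G x \<bullet> h)) (at x)) \<and>
            (\<forall>x\<in>S. \<forall>y\<in>S. norm (G x - G y) \<le> L * norm (x - y) powr \<alpha>))"

text \<open>Near each point of the portion \<open>T\<close>, in orthogonal coordinates with last axis \<open>e\<close>, the set
  \<open>U\<close> is the part above the graph of a \<open>C\<^sup>1\<^sup>,\<^sup>\<alpha>\<close> function of the remaining coordinates.  A function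
  on the hyperplane orthogonal to \<open>e\<close> is represented by a function \<open>\<phi>\<close> on the whole space that is
  only evaluated at the projections \<open>x - (x \<bullet> e) e\<close>.\<close>

definition C1_holder_boundary :: "real \<Rightarrow> (real^'n) set \<Rightarrow> (real^'n) set \<Rightarrow> bool" where
  "C1_holder_boundary \<alpha> U T \<longleftrightarrow>
     (\<forall>x0\<in>T. \<exists>e r \<phi>. norm e = 1 \<and> 0 < r \<and>
        C1_holder_on \<alpha> \<phi> (ball (x0 - (x0 \<bullet> e) *\<^sub>R e) r) \<and>
        U \<inter> ball x0 r = {x \<in> ball x0 r. \<phi> (x - (x \<bullet> e) *\<^sub>R e) < x \<bullet> e})"

text \<open>The second conjunct says that \<open>\<nu>\<close> is orthogonal to all tangent directions of the boundary at
  \<open>x\<close>, the third that it points into \<open>U\<close>.  At a \<open>C\<^sup>1\<close> boundary point there is exactly one such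
  vector.\<close>

definition is_inward_unit_normal :: "(real^'n) set \<Rightarrow> real^'n \<Rightarrow> real^'n \<Rightarrow> bool" where
  "is_inward_unit_normal U x \<nu> \<longleftrightarrow> norm \<nu> = 1 \<and>
     ((\<lambda>y. (\<nu> \<bullet> (y - x)) / norm (y - x)) \<longlongrightarrow> 0) (at x within frontier U) \<and>
     (\<forall>\<^sub>F t in at_right (0::real). x + t *\<^sub>R \<nu> \<in> U)"

definition inward_normal :: "(real^'n) set \<Rightarrow> real^'n \<Rightarrow> real^'n" where
  "inward_normal U x = (THE \<nu>. is_inward_unit_normal U x \<nu>)"

subsection \<open>Function spaces\<close>

text \<open>Functions on \<open>U\<close> are total functions whose values off \<open>U\<close> are irrelevant; membership in a
  space of functions on a larger set means that the relevant quantities extend continuously from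
  \<open>U\<close>.\<close>

definition grad :: "(real^'n \<Rightarrow> real) \<Rightarrow> real^'n \<Rightarrow> real^'n" where
  "grad u x = (\<chi> i. frechet_derivative u (at x) (axis i 1))"

definition hessian :: "(real^'n \<Rightarrow> real) \<Rightarrow> real^'n \<Rightarrow> real^'n^'n" where
  "hessian u x = jacobian (grad u) (at x)"

definition C2 :: "(real^'n) set \<Rightarrow> (real^'n \<Rightarrow> real) set" where
  "C2 U = {u. (\<forall>x\<in>U. u differentiable (at x)) \<and> (\<forall>x\<in>U. grad u differentiable (at x)) \<and>
              continuous_on U (hessian u)}"

definition C1_up_to :: "(real^'n) set \<Rightarrow> (real^'n) set \<Rightarrow> (real^'n \<Rightarrow> real) set" where
  "C1_up_to U S = {u. (\<forall>x\<in>U. u differentiable (at x)) \<and>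
     (\<exists>v. continuous_on S v \<and> (\<forall>x\<in>U. v x = u x)) \<and>
     (\<exists>G. continuous_on S G \<and> (\<forall>x\<in>U. G x = grad u x))}"

definition C2s :: "(real^'n) set \<Rightarrow> (real^'n \<Rightarrow> real^'n^'n) \<Rightarrow> (real^'n \<Rightarrow> real) set" where
  "C2s U a = {u \<in> C2 U \<inter> C1_up_to U (with_deg_boundary U a).
     \<exists>g. continuous_on (with_deg_boundary U a) g \<and>
         (\<forall>x\<in>U. g x = trace (a x ** hessian u x)) \<and>
         (\<forall>x\<in>deg_boundary U a. g x = 0)}"

text \<open>The ball includes its centre, so this is the envelope on all of \<open>closure U\<close>.\<close>

definition usc_envelope :: "(real^'n) set \<Rightarrow> (real^'n \<Rightarrow> real) \<Rightarrow> real^'n \<Rightarrow> ereal" where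
  "usc_envelope U u x = (INF r\<in>{0<..}. SUP y\<in>U \<inter> ball x r. ereal (u y))"

subsection \<open>The operator and the weak maximum principle property\<close>

definition elliptic_op ::
  "(real^'n \<Rightarrow> real^'n^'n) \<Rightarrow> (real^'n \<Rightarrow> real^'n) \<Rightarrow> (real^'n \<Rightarrow> real) \<Rightarrow>
   (real^'n \<Rightarrow> real) \<Rightarrow> real^'n \<Rightarrow> real" where
  "elliptic_op a b c u x = - trace (a x ** hessian u x) - b x \<bullet> grad u x + c x * u x"

definition function_convex_cone :: "(real^'n \<Rightarrow> real) set \<Rightarrow> bool" where
  "function_convex_cone C \<longleftrightarrow> C \<noteq> {} \<and>
     (\<forall>u\<in>C. \<forall>v\<in>C. (\<lambda>x. u x + v x) \<in> C) \<and> (\<forall>u\<in>C. \<forall>t\<ge>0. (\<lambda>x. t * u x) \<in> C)"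

definition weak_max_principle_property ::
  "(real^'n) set \<Rightarrow> (real^'n) set \<Rightarrow> ((real^'n \<Rightarrow> real) \<Rightarrow> real^'n \<Rightarrow> real) \<Rightarrow>
   (real^'n \<Rightarrow> real) set \<Rightarrow> bool" where
  "weak_max_principle_property U \<Sigma> A C \<longleftrightarrow>
     openin (top_of_set (frontier U)) \<Sigma> \<and> function_convex_cone C \<and> C \<subseteq> C2 U \<and>
     (\<forall>u\<in>C. (\<forall>x\<in>U. A u x \<le> 0) \<and> (\<forall>x\<in>frontier U - closure \<Sigma>. usc_envelope U u x \<le> 0)
        \<longrightarrow> (\<forall>x\<in>U. u x \<le> 0))"

end

theory Submission
  imports Defs
begin

text \<open>
  Suppose that \<open>u\<close> is positive at some point \<open>z\<close>. As \<open>U\<close> may be unbounded, \<open>u\<close> need not attain its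
  supremum, so one subtracts a small multiple of \<open>ln (1 + |x|\<^sup>2)\<close>. This barrier tends to infinity
  while the growth condition on the coefficients keeps the second and first order part of the
  operator applied to it bounded; a faster growing barrier such as \<open>1 + |x|\<^sup>2\<close> would have to compete
  with \<open>c0\<close>, which may be smaller than \<open>K\<close>. The difference attains a positive maximum at a point
  \<open>x0\<close> of \<open>U\<close> or of the degenerate boundary, because the envelope condition excludes the rest of the
  boundary. By concavity of the logarithm, \<open>u\<close> is then touched from above at \<open>x0\<close> by a
  function \<open>const + k |x|\<^sup>2 / 2\<close> with \<open>k = 2 \<epsilon> / (1 + |x0|\<^sup>2)\<close>
  (lemma \<open>exists_quadratic_touching_point\<close>).

  If \<open>x0\<close> is an interior point, the first and second derivative tests bound the operator from below
  (\<open>elliptic_op_touching_interior\<close>); the trace term is handled by the fact that the product of a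
  nonnegative symmetric matrix and a matrix with nonpositive quadratic form has nonpositive trace
  (\<open>sym_nonneg_trace_mult_nonpos\<close>). If \<open>x0\<close> is a degenerate boundary point, the second order term
  tends to zero there by the definition of the function space, and the derivative of
  \<open>u - k |x|\<^sup>2 / 2\<close> in the direction \<open>b\<close>, which does not point out of \<open>U\<close>, is not positive
  (\<open>boundary_max_gradient\<close>, \<open>elliptic_op_touching_boundary\<close>). Both cases give
  \<open>c0 * u x0 \<le> M + 2 \<epsilon> K\<close> for every upper bound \<open>M\<close> of the operator, and \<open>\<epsilon> \<rightarrow> 0\<close> gives
  \<open>c0 * u z \<le> M\<close> (\<open>maximum_principle_bound\<close>).

  The weak maximum principle property is the case \<open>M = 0\<close>, together with the fact that the function
  class is a convex cone. The envelope condition in that class on the limit points of the degenerate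
  boundary that do not belong to it completes the one on the boundary away from its closure.
\<close>

section \<open>Traces of products of semidefinite matrices\<close>

text \<open>This is the Cholesky decomposition run as an induction. If the pivot \<open>M $ i $ i\<close> is positive,
  subtracting the rank one matrix built from the \<open>i\<close>-th row leaves a nonnegative matrix (by the
  Cauchy-Schwarz inequality for the form of \<open>M\<close>) whose \<open>i\<close>-th row vanishes, and the removed
  rank one matrix contributes one value of the form of \<open>H\<close> to the trace. If the pivot is zero, the
  whole row is zero. The set \<open>I\<close> contains the rows that are not yet eliminated.\<close>

lemma sym_nonneg_trace_mult_nonpos_supported:
  fixes M H :: "real^'n^'n"
  assumes "finite I" "sym_nonneg M" "\<And>i j. M $ i $ j \<noteq> 0 \<Longrightarrow> i \<in> I"
    and H: "\<And>v. v \<bullet> (H *v v) \<le> 0"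
  shows "trace (M ** H) \<le> 0"
  using assms(1-3)
proof (induction I arbitrary: M rule: finite_induct)
  case empty
  then have "M = 0" by (auto simp: vec_eq_iff)
  then show ?case by (simp add: trace_def)
next
  case (insert i I)
  let ?r = "M $ i"
  let ?p = "M $ i $ i"
  have sym: "M $ j $ k = M $ k $ j" for j k
  proof -
    have "transpose M $ k $ j = M $ k $ j" using insert.prems(1) by (simp add: sym_nonneg_def)
    then show ?thesis by (simp add: transpose_def)
  qed
  have psd: "0 \<le> v \<bullet> (M *v v)" for v
    using insert.prems(1) unfolding sym_nonneg_def by blast
  have Mi: "M *v axis i 1 = ?r"
    by (simp add: vec_eq_iff matrix_vector_mult_basis column_def sym)
  have form: "(v - s *\<^sub>R axis i 1) \<bullet> (M *v (v - s *\<^sub>R axis i 1))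
      = v \<bullet> (M *v v) - 2 * s * (?r \<bullet> v) + s\<^sup>2 * ?p" for v s
  proof -
    have "axis i 1 \<bullet> (M *v v) = ?r \<bullet> v"
      unfolding inner_axis' by (simp add: matrix_vector_mult_def inner_vec_def)
    moreover have "axis i 1 \<bullet> ?r = ?p" by (simp add: inner_axis')
    ultimately show ?thesis
      by (simp add: matrix_vector_mult_diff_distrib matrix_vector_mult_scaleR Mi inner_diff_left
          inner_diff_right inner_commute[of v ?r] power2_eq_square algebra_simps)
  qed
  have p0: "0 \<le> ?p"
    using form[of 0 1] psd[of "0 - 1 *\<^sub>R axis i 1"] by simp
  show ?case
  proof (cases "?p = 0")
    case True
    have row0: "?r \<bullet> v = 0" for v
    proof (rule ccontr)
      assume ne: "?r \<bullet> v \<noteq> 0"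
      \<comment> \<open>the value of \<open>s\<close> at which the form, affine in \<open>s\<close> for a zero pivot, equals \<open>- 1\<close>\<close>
      define s where "s = (v \<bullet> (M *v v) + 1) / (2 * (?r \<bullet> v))"
      have "0 \<le> v \<bullet> (M *v v) - 2 * s * (?r \<bullet> v)"
        using form[of v s] psd[of "v - s *\<^sub>R axis i 1"] True by simp
      then show False using ne by (simp add: s_def)
    qed
    have "?r = 0" using row0[of ?r] by simp
    then have "k \<in> I" if "M $ k $ l \<noteq> 0" for k l
      using insert.prems(2)[OF that] that by auto
    with insert.IH[OF insert.prems(1)] show ?thesis by blast
  next
    case False
    with p0 have p: "0 < ?p" by simp
    define M' :: "real^'n^'n" where "M' = (\<chi> k l. M $ k $ l - ?r $ k * ?r $ l / ?p)"
    have M'v: "v \<bullet> (M' *v v) = v \<bullet> (M *v v) - (?r \<bullet> v)\<^sup>2 / ?p" for v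
    proof -
      have "M' *v v = M *v v - ((?r \<bullet> v) / ?p) *\<^sub>R ?r"
        by (simp add: vec_eq_iff M'_def matrix_vector_mult_def inner_vec_def algebra_simps
            sum_subtractf sum_distrib_left sum_divide_distrib)
      then show ?thesis
        by (simp add: inner_diff_right inner_commute[of v ?r] power2_eq_square)
    qed
    \<comment> \<open>Cauchy-Schwarz: the form of \<open>M\<close> at the minimizing multiple of the \<open>i\<close>-th axis\<close>
    have "0 \<le> v \<bullet> (M' *v v)" for v
      using form[of v "(?r \<bullet> v) / ?p"] psd[of "v - ((?r \<bullet> v) / ?p) *\<^sub>R axis i 1"] p
      by (simp add: M'v power2_eq_square)
    moreover have "transpose M' = M'"
      by (simp add: vec_eq_iff M'_def transpose_def sym mult.commute)
    ultimately have s': "sym_nonneg M'" by (simp add: sym_nonneg_def)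
    have "k \<in> I" if "M' $ k $ l \<noteq> 0" for k l
    proof -
      have "k \<noteq> i" using that p by (auto simp: M'_def)
      moreover have "M $ k $ l \<noteq> 0 \<or> M $ k $ i \<noteq> 0"
        using that sym[of i k] by (auto simp: M'_def)
      ultimately show ?thesis using insert.prems(2) by blast
    qed
    with insert.IH[OF s'] have le: "trace (M' ** H) \<le> 0" by blast
    have "trace (M ** H) = trace (M' ** H) + (?r \<bullet> (H *v ?r)) / ?p"
    proof -
      have "trace (M ** H) - trace (M' ** H) = (\<Sum>k\<in>UNIV. \<Sum>l\<in>UNIV. ?r $ k * ?r $ l / ?p * H $ l $ k)"
        by (simp add: trace_def matrix_matrix_mult_def M'_def algebra_simps flip: sum_subtractf)
      also have "\<dots> = (\<Sum>l\<in>UNIV. \<Sum>k\<in>UNIV. ?r $ k * ?r $ l / ?p * H $ l $ k)"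
        by (rule sum.swap)
      also have "\<dots> = (?r \<bullet> (H *v ?r)) / ?p"
        by (simp add: inner_vec_def matrix_vector_mult_def sum_distrib_left sum_divide_distrib
            algebra_simps)
      finally show ?thesis by simp
    qed
    moreover have "(?r \<bullet> (H *v ?r)) / ?p \<le> 0"
      using H[of ?r] p by (simp add: divide_le_0_iff)
    ultimately show ?thesis using le by linarith
  qed
qed

lemma sym_nonneg_trace_mult_nonpos:
  fixes M H :: "real^'n^'n"
  assumes "sym_nonneg M" "\<And>v. v \<bullet> (H *v v) \<le> 0"
  shows "trace (M ** H) \<le> 0"
  using sym_nonneg_trace_mult_nonpos_supported[of UNIV M H] assms by simp

section \<open>Gradient and Hessian\<close>

lemma has_derivative_grad:
  fixes u :: "real^'n \<Rightarrow> real"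
  assumes "u differentiable (at x)"
  shows "(u has_derivative (\<lambda>h. grad u x \<bullet> h)) (at x)"
proof -
  let ?f = "frechet_derivative u (at x)"
  have d: "(u has_derivative ?f) (at x)" using assms frechet_derivative_works by blast
  then interpret linear ?f by (rule has_derivative_linear)
  have "?f h = grad u x \<bullet> h" for h
  proof -
    have "?f h = ?f (\<Sum>i\<in>UNIV. (h $ i) *s axis i 1)" by (simp add: basis_expansion)
    also have "\<dots> = (\<Sum>i\<in>UNIV. h $ i * ?f (axis i 1))"
      by (simp add: sum scale scalar_mult_eq_scaleR)
    finally show ?thesis by (simp add: grad_def inner_vec_def mult.commute)
  qed
  then have "?f = (\<lambda>h. grad u x \<bullet> h)" by auto
  with d show ?thesis by simp
qed

lemma grad_eqI:
  fixes u :: "real^'n \<Rightarrow> real"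
  assumes "(u has_derivative (\<lambda>h. g \<bullet> h)) (at x)"
  shows "grad u x = g"
proof -
  have "frechet_derivative u (at x) = (\<lambda>h. g \<bullet> h)"
    using frechet_derivative_at[OF assms] by simp
  then show ?thesis by (simp add: grad_def vec_eq_iff inner_axis)
qed

lemma has_derivative_hessian:
  assumes "grad u differentiable (at x)"
  shows "(grad u has_derivative (\<lambda>h. hessian u x *v h)) (at x)"
  using assms by (simp add: hessian_def jacobian_works)

lemma hessian_eqI:
  assumes "(grad u has_derivative (\<lambda>h. M *v h)) (at x)"
  shows "hessian u x = M"
proof -
  have "frechet_derivative (grad u) (at x) = (\<lambda>h. M *v h)"
    using frechet_derivative_at[OF assms] by simp
  then show ?thesis by (simp add: hessian_def jacobian_def)
qed

text \<open>The difference of \<open>u\<close> and the quadratic function has an interior maximum at \<open>x0\<close>. Its gradient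
  vanishes there, and along any line its first derivative cannot start to grow, which bounds the
  second derivative.\<close>

lemma quadratic_touching_interior:
  fixes u :: "real^'n \<Rightarrow> real"
  assumes U: "open U" "x0 \<in> U" and u: "u \<in> C2 U"
    and touch: "\<forall>x\<in>U. u x \<le> u x0 + k / 2 * ((norm x)\<^sup>2 - (norm x0)\<^sup>2)"
  shows "grad u x0 = k *\<^sub>R x0" "h \<bullet> (hessian u x0 *v h) \<le> k * (h \<bullet> h)"
proof -
  define w where "w = (\<lambda>x. u x - k / 2 * (x \<bullet> x))"
  have w_max: "w x \<le> w x0" if "x \<in> U" for x
    using touch that by (simp add: w_def power2_norm_eq_inner algebra_simps)
  have dw: "(w has_derivative (\<lambda>h. (grad u x - k *\<^sub>R x) \<bullet> h)) (at x)" if "x \<in> U" for x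
    unfolding w_def using u that
    by (auto simp: C2_def intro!: derivative_eq_intros has_derivative_grad)
      (simp add: algebra_simps inner_commute)
  have "(\<lambda>h. (grad u x0 - k *\<^sub>R x0) \<bullet> h) = (\<lambda>h. 0)"
    by (rule differential_zero_maxmin[OF U(2,1) dw[OF U(2)]]) (use w_max in blast)
  then have "(grad u x0 - k *\<^sub>R x0) \<bullet> (grad u x0 - k *\<^sub>R x0) = 0" by metis
  then show g0: "grad u x0 = k *\<^sub>R x0" by simp
  show "h \<bullet> (hessian u x0 *v h) \<le> k * (h \<bullet> h)"
  proof (rule ccontr)
    assume neg: "\<not> ?thesis"
    define p where "p = (\<lambda>t. x0 + t *\<^sub>R h)"
    define q where "q = (\<lambda>t. (grad u (p t) - k *\<^sub>R p t) \<bullet> h)"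
    have dp: "(p has_derivative (\<lambda>s. s *\<^sub>R h)) (at t)" for t
      unfolding p_def by (auto intro!: derivative_eq_intros)
    have p0: "p 0 = x0" by (simp add: p_def)
    have dw': "((\<lambda>t. w (p t)) has_real_derivative q t) (at t)" if "p t \<in> U" for t
      using has_derivative_compose[OF dp dw[OF that]]
      by (simp add: q_def has_field_derivative_def mult.commute[of _ "_ \<bullet> _"])
    have dg: "(grad u has_derivative (\<lambda>h. hessian u x0 *v h)) (at (p 0))"
      unfolding p0 using u U(2) by (intro has_derivative_hessian) (auto simp: C2_def)
    have "(q has_derivative (\<lambda>s. (hessian u x0 *v (s *\<^sub>R h) - k *\<^sub>R (s *\<^sub>R h)) \<bullet> h)) (at 0)"
      unfolding q_def
      by (intro has_derivative_inner_left has_derivative_diff has_derivative_scaleR_right dp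
          has_derivative_compose[OF dp dg])
    moreover have "(\<lambda>s. (hessian u x0 *v (s *\<^sub>R h) - k *\<^sub>R (s *\<^sub>R h)) \<bullet> h)
        = (*) (h \<bullet> (hessian u x0 *v h) - k * (h \<bullet> h))"
      by (simp add: fun_eq_iff matrix_vector_mult_scaleR inner_diff_left inner_commute algebra_simps)
    ultimately have dq:
      "(q has_real_derivative (h \<bullet> (hessian u x0 *v h) - k * (h \<bullet> h))) (at 0)"
      unfolding has_field_derivative_def by (rule has_derivative_eq_rhs)
    have q0: "q 0 = 0" by (simp add: q_def p0 g0)
    obtain d1 where d1: "0 < d1" "\<forall>s>0. s < d1 \<longrightarrow> q 0 < q (0 + s)"
      using DERIV_pos_inc_right[OF dq] neg by auto
    have "continuous_on UNIV p" unfolding p_def by (intro continuous_intros)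
    then have "open (p -` U)" using U(1) open_vimage by blast
    moreover have "0 \<in> p -` U" using U(2) p0 by simp
    ultimately obtain d2 where d2: "0 < d2" "ball 0 d2 \<subseteq> p -` U"
      using open_contains_ball by blast
    define s where "s = min d1 d2 / 2"
    have s: "0 < s" "s < d1" "s < d2" using d1(1) d2(1) by (auto simp: s_def)
    have pU: "p t \<in> U" if "0 \<le> t" "t \<le> s" for t
      using d2(2) that s by (auto simp: subset_iff dist_real_def)
    obtain z where z: "0 < z" "z < s" "w (p s) - w (p 0) = (s - 0) * q z"
      using MVT2[of 0 s "\<lambda>t. w (p t)" q] s(1) dw' pU by auto
    have "0 < q z" using d1(2) z s q0 by simp
    then have "0 < w (p s) - w (p 0)" using z s by simp
    moreover have "w (p s) \<le> w (p 0)" using w_max[OF pU[of s]] s p0 by simp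
    ultimately show False by simp
  qed
qed

section \<open>The inward normal and first order conditions at the boundary\<close>

text \<open>Near \<open>x0\<close> the set \<open>U\<close> is the positivity set of \<open>g\<close>, the height above the boundary graph measured
  in the direction \<open>e\<close>, and \<open>\<Gamma>\<close> is the gradient of \<open>g\<close> at \<open>x0\<close>. That \<open>g\<close> grows with unit
  speed along \<open>e\<close> allows one to drop any point onto the zero set of \<open>g\<close>.\<close>

locale graph_chart =
  fixes U :: "(real^'n) set" and x0 e \<Gamma> :: "real^'n" and r :: real and g :: "real^'n \<Rightarrow> real"
  assumes r_pos: "0 < r"
    and U_iff: "\<And>x. x \<in> ball x0 r \<Longrightarrow> x \<in> U \<longleftrightarrow> 0 < g x"
    and cont_g: "continuous_on (ball x0 r) g"
    and deriv_g: "(g has_derivative (\<lambda>h. \<Gamma> \<bullet> h)) (at x0)"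
    and g_shift: "\<And>x s. g (x + s *\<^sub>R e) = g x + s"
    and norm_e: "norm e = 1"
    and \<Gamma>_nonzero: "\<Gamma> \<noteq> 0"
    and x0_frontier: "x0 \<in> frontier U"

text \<open>With \<open>P\<close> the orthogonal projection along \<open>e\<close>, the function is \<open>g x = x \<bullet> e - \<phi> (P x)\<close>. The
  component of its gradient along \<open>e\<close> is 1, so the gradient does not vanish.\<close>

lemma C1_holder_boundary_graph_chart:
  fixes U :: "(real^'n) set"
  assumes "C1_holder_boundary \<alpha> U T" "x0 \<in> T" "x0 \<in> frontier U"
  obtains e \<Gamma> r g where "graph_chart U x0 e \<Gamma> r g"
proof -
  obtain e r \<phi> where *: "norm e = 1" "0 < r"
        "C1_holder_on \<alpha> \<phi> (ball (x0 - (x0 \<bullet> e) *\<^sub>R e) r)"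
        "U \<inter> ball x0 r = {x \<in> ball x0 r. \<phi> (x - (x \<bullet> e) *\<^sub>R e) < x \<bullet> e}"
    using bspec[OF assms(1)[unfolded C1_holder_boundary_def] assms(2)] by (elim exE conjE) (rule that)
  then obtain G where G: "\<And>x. x \<in> ball (x0 - (x0 \<bullet> e) *\<^sub>R e) r \<Longrightarrow> (\<phi> has_derivative (\<lambda>h. G x \<bullet> h)) (at x)"
    unfolding C1_holder_on_def by (elim exE conjE) blast
  define P where "P = (\<lambda>x. x - (x \<bullet> e) *\<^sub>R e)"
  define g where "g = (\<lambda>x. x \<bullet> e - \<phi> (P x))"
  define D where "D = (\<lambda>x. e - G (P x) + (G (P x) \<bullet> e) *\<^sub>R e)"
  have ee: "e \<bullet> e = 1" using *(1) by (simp add: norm_eq_1)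
  have P_ball: "P x \<in> ball (P x0) r" if "x \<in> ball x0 r" for x
  proof -
    define d where "d = x0 - x"
    have "P x0 - P x = d - (d \<bullet> e) *\<^sub>R e"
      by (simp add: P_def d_def inner_diff_left scaleR_diff_left)
    moreover have "(norm (d - (d \<bullet> e) *\<^sub>R e))\<^sup>2 \<le> (norm d)\<^sup>2"
      by (simp add: power2_norm_eq_inner inner_diff_left inner_diff_right ee inner_commute[of e d])
    ultimately have "norm (P x0 - P x) \<le> norm d"
      by (metis norm_ge_zero power2_le_imp_le)
    with that show ?thesis by (simp add: dist_norm d_def)
  qed
  have dP: "(P has_derivative (\<lambda>h. h - (h \<bullet> e) *\<^sub>R e)) (at x)" for x
    unfolding P_def by (auto intro!: derivative_eq_intros)
  have dg: "(g has_derivative (\<lambda>h. D x \<bullet> h)) (at x)" if "x \<in> ball x0 r" for x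
  proof -
    have "(\<phi> has_derivative (\<lambda>h. G (P x) \<bullet> h)) (at (P x))"
      using G[of "P x"] P_ball[OF that] by (simp add: P_def)
    from has_derivative_diff[OF has_derivative_inner_left[OF has_derivative_ident, of e]
        has_derivative_compose[OF dP this]]
    have "(g has_derivative (\<lambda>h. h \<bullet> e - G (P x) \<bullet> (h - (h \<bullet> e) *\<^sub>R e))) (at x)"
      by (simp add: g_def)
    moreover have "(\<lambda>h. h \<bullet> e - G (P x) \<bullet> (h - (h \<bullet> e) *\<^sub>R e)) = (\<lambda>h. D x \<bullet> h)"
      by (simp add: fun_eq_iff D_def inner_diff_left inner_add_left inner_diff_right
          inner_commute[of e])
    ultimately show ?thesis by simp
  qed
  have "graph_chart U x0 e (D x0) r g"
  proof
    show "0 < r" "norm e = 1" "x0 \<in> frontier U" by fact+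
    show "x \<in> U \<longleftrightarrow> 0 < g x" if "x \<in> ball x0 r" for x
    proof -
      have "x \<in> U \<longleftrightarrow> x \<in> U \<inter> ball x0 r" using that by blast
      also have "\<dots> \<longleftrightarrow> 0 < g x" unfolding *(4) using that by (simp add: g_def P_def)
      finally show ?thesis .
    qed
    show "continuous_on (ball x0 r) g"
      using has_derivative_continuous[OF dg] by (blast intro: continuous_at_imp_continuous_on)
    show "(g has_derivative (\<lambda>h. D x0 \<bullet> h)) (at x0)" using dg *(2) by simp
    show "g (x + s *\<^sub>R e) = g x + s" for x s
      by (simp add: g_def P_def inner_add_left ee algebra_simps)
    have "D x0 \<bullet> e = 1" by (simp add: D_def inner_diff_left inner_add_left ee)
    then show "D x0 \<noteq> 0" by auto
  qed
  then show ?thesis by (rule that)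
qed

context graph_chart
begin

lemma frontier_iff:
  assumes "y \<in> ball x0 r"
  shows "y \<in> frontier U \<longleftrightarrow> g y = 0"
proof
  have eventually_at_in_set: "\<forall>\<^sub>F x in at y within U. x \<in> U"
    by (simp add: eventually_at_filter)
  have "(g \<longlongrightarrow> g y) (at y)"
    using cont_g assms by (simp add: continuous_on_eq_continuous_at isCont_def)
  then have lim_g: "(g \<longlongrightarrow> g y) (at y within S)" for S
    by (rule Lim_at_imp_Lim_at_within)
  assume y: "y \<in> frontier U"
  have near: "\<forall>\<^sub>F x in at y within S. x \<in> ball x0 r" for S
    using assms unfolding eventually_at_topological by (intro exI[of _ "ball x0 r"]) auto
  have "0 \<le> g y"
  proof (cases "y \<in> U")
    case True then show ?thesis using U_iff[OF assms] by simp
  next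
    case False
    have nb: "at y within U \<noteq> bot"
      using y False by (simp add: at_within_eq_bot_iff frontier_def)
    have "\<forall>\<^sub>F x in at y within U. 0 \<le> g x"
      using near[of U] eventually_at_in_set
      by eventually_elim (simp add: U_iff less_imp_le)
    then show ?thesis using tendsto_lowerbound[OF lim_g _ nb] by blast
  qed
  moreover have "\<not> 0 < g y"
  proof
    assume "0 < g y"
    then have "\<forall>\<^sub>F x in at y. 0 < g x" by (rule order_tendstoD(1)[OF lim_g])
    with near[of UNIV] have "\<forall>\<^sub>F x in at y. x \<in> U"
      by eventually_elim (simp add: U_iff)
    moreover have "y \<in> U" using \<open>0 < g y\<close> U_iff[OF assms] by simp
    ultimately have "\<forall>\<^sub>F x in nhds y. x \<in> U" by (simp add: eventually_nhds_conv_at)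
    then have "y \<in> interior U" unfolding eventually_nhds by (auto intro: interiorI)
    with y show False by (simp add: frontier_def)
  qed
  ultimately show "g y = 0" by simp
next
  assume g0: "g y = 0"
  then have "y \<notin> U" using U_iff[OF assms] by simp
  moreover have "y \<in> closure U"
    unfolding closure_approachable
  proof (intro allI impI)
    fix \<epsilon> :: real assume "0 < \<epsilon>"
    define s where "s = min \<epsilon> (r - dist x0 y) / 2"
    have s: "0 < s" "s < \<epsilon>" "s < r - dist x0 y"
      using assms \<open>0 < \<epsilon>\<close> by (auto simp: s_def min_def)
    have d: "dist (y + s *\<^sub>R e) y = s" using s norm_e by (simp add: dist_norm)
    have "y + s *\<^sub>R e \<in> ball x0 r"
      using dist_triangle[of x0 "y + s *\<^sub>R e" y] d s by (simp add: dist_commute)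
    then have "y + s *\<^sub>R e \<in> U" using U_iff g_shift g0 s by simp
    then show "\<exists>z\<in>U. dist z y < \<epsilon>"
      using d s(2) by (intro bexI[of _ "y + s *\<^sub>R e"]) simp_all
  qed
  ultimately show "y \<in> frontier U"
    using interior_subset by (auto simp: frontier_def)
qed

lemma x0_ball: "x0 \<in> ball x0 r" using r_pos by simp

lemma g_x0: "g x0 = 0"
  using frontier_iff[OF x0_ball] x0_frontier by simp

lemma directional_limit: "((\<lambda>t. g (x0 + t *\<^sub>R h) / t) \<longlongrightarrow> \<Gamma> \<bullet> h) (at_right 0)"
proof -
  have "((\<lambda>t. x0 + t *\<^sub>R h) has_derivative (\<lambda>t. t *\<^sub>R h)) (at 0)"
    by (auto intro!: derivative_eq_intros)
  from has_derivative_compose[OF this, of g "\<lambda>h. \<Gamma> \<bullet> h"] deriv_g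
  have "((\<lambda>t. g (x0 + t *\<^sub>R h)) has_derivative (\<lambda>t. \<Gamma> \<bullet> (t *\<^sub>R h))) (at 0)"
    by simp
  then have "((\<lambda>t. g (x0 + t *\<^sub>R h)) has_real_derivative \<Gamma> \<bullet> h) (at 0)"
    unfolding has_field_derivative_def by (rule has_derivative_eq_rhs) (simp add: fun_eq_iff)
  then have "((\<lambda>t. g (x0 + t *\<^sub>R h) / t) \<longlongrightarrow> \<Gamma> \<bullet> h) (at 0)"
    by (simp add: has_field_derivative_iff g_x0)
  then show ?thesis by (rule filterlim_mono) (auto simp: at_le)
qed

lemma eventually_ball: "\<forall>\<^sub>F t in at_right 0. x0 + t *\<^sub>R h \<in> ball x0 r"
proof -
  have "((\<lambda>t. x0 + t *\<^sub>R h) \<longlongrightarrow> x0 + 0 *\<^sub>R h) (at_right 0)" by (intro tendsto_intros)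
  from topological_tendstoD[OF this open_ball, of x0 r] x0_ball show ?thesis by simp
qed

lemma eventually_in:
  assumes "0 < \<Gamma> \<bullet> h"
  shows "\<forall>\<^sub>F t in at_right 0. x0 + t *\<^sub>R h \<in> U"
  using order_tendstoD(1)[OF directional_limit assms] eventually_ball[of h]
    eventually_at_right_less[of 0]
  by eventually_elim (simp add: U_iff zero_less_divide_iff)

lemma eventually_not_in:
  assumes "\<Gamma> \<bullet> h < 0"
  shows "\<forall>\<^sub>F t in at_right 0. x0 + t *\<^sub>R h \<notin> U"
  using order_tendstoD(2)[OF directional_limit assms] eventually_ball[of h]
    eventually_at_right_less[of 0]
  by eventually_elim (simp add: U_iff divide_less_0_iff)

lemma is_inward_unit_normal_gradient: "is_inward_unit_normal U x0 (\<Gamma> /\<^sub>R norm \<Gamma>)"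
  unfolding is_inward_unit_normal_def
proof (intro conjI)
  show "norm (\<Gamma> /\<^sub>R norm \<Gamma>) = 1" using \<Gamma>_nonzero by simp
  have "0 < \<Gamma> \<bullet> (\<Gamma> /\<^sub>R norm \<Gamma>)" using \<Gamma>_nonzero by simp
  then show "\<forall>\<^sub>F t in at_right 0. x0 + t *\<^sub>R (\<Gamma> /\<^sub>R norm \<Gamma>) \<in> U" by (rule eventually_in)
  have "((\<lambda>y. (g y - g x0 - \<Gamma> \<bullet> (y - x0)) /\<^sub>R norm (y - x0)) \<longlongrightarrow> 0) (at x0 within frontier U)"
    using has_derivative_at_withinI[OF deriv_g] unfolding has_derivative_at_within by simp
  then have lim: "((\<lambda>y. (- inverse (norm \<Gamma>)) * ((g y - g x0 - \<Gamma> \<bullet> (y - x0)) /\<^sub>R norm (y - x0)))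
      \<longlongrightarrow> - inverse (norm \<Gamma>) * 0) (at x0 within frontier U)"
    by (rule tendsto_mult_left)
  have "\<forall>\<^sub>F y in at x0 within frontier U. y \<in> ball x0 r \<and> y \<in> frontier U"
    using x0_ball unfolding eventually_at_topological by (intro exI[of _ "ball x0 r"]) auto
  then have "\<forall>\<^sub>F y in at x0 within frontier U.
      (- inverse (norm \<Gamma>)) * ((g y - g x0 - \<Gamma> \<bullet> (y - x0)) /\<^sub>R norm (y - x0))
      = ((\<Gamma> /\<^sub>R norm \<Gamma>) \<bullet> (y - x0)) / norm (y - x0)"
  proof eventually_elim
    case (elim y)
    then have "g y = 0" using frontier_iff by blast
    then show ?case by (simp add: g_x0 divide_simps)
  qed
  from Lim_transform_eventually[OF lim this]
  show "((\<lambda>y. ((\<Gamma> /\<^sub>R norm \<Gamma>) \<bullet> (y - x0)) / norm (y - x0)) \<longlongrightarrow> 0) (at x0 within frontier U)"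
    by simp
qed

text \<open>A vector \<open>h\<close> orthogonal to \<open>\<Gamma>\<close> is tangent to the boundary: dropping \<open>x0 + t h\<close> onto the graph
  along \<open>e\<close> gives boundary points \<open>y t = x0 + t h + o(t)\<close>, to which the defining limit of the
  normal applies.\<close>

lemma inward_unit_normal_orthogonal:
  assumes \<nu>: "is_inward_unit_normal U x0 \<nu>" and h: "\<Gamma> \<bullet> h = 0"
  shows "\<nu> \<bullet> h = 0"
proof (cases "h = 0")
  case False
  define y where "y = (\<lambda>t. x0 + t *\<^sub>R h - g (x0 + t *\<^sub>R h) *\<^sub>R e)"
  have quot: "((\<lambda>t. (y t - x0) /\<^sub>R t) \<longlongrightarrow> h - 0 *\<^sub>R e) (at_right 0)"
  proof (rule Lim_transform_eventually)
    show "((\<lambda>t. h - (g (x0 + t *\<^sub>R h) / t) *\<^sub>R e) \<longlongrightarrow> h - 0 *\<^sub>R e) (at_right 0)"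
      using directional_limit[of h] h by (intro tendsto_intros) simp
    show "\<forall>\<^sub>F t in at_right 0. h - (g (x0 + t *\<^sub>R h) / t) *\<^sub>R e = (y t - x0) /\<^sub>R t"
      using eventually_at_right_less[of 0]
      by eventually_elim (simp add: y_def algebra_simps divide_inverse_commute)
  qed
  then have quot: "((\<lambda>t. (y t - x0) /\<^sub>R t) \<longlongrightarrow> h) (at_right 0)" by simp
  have "((\<lambda>t. x0 + t *\<^sub>R ((y t - x0) /\<^sub>R t)) \<longlongrightarrow> x0 + 0 *\<^sub>R h) (at_right 0)"
    by (intro tendsto_intros quot)
  moreover have "\<forall>\<^sub>F t in at_right 0. x0 + t *\<^sub>R ((y t - x0) /\<^sub>R t) = y t"
    using eventually_at_right_less[of 0] by eventually_elim simp
  ultimately have y_lim: "(y \<longlongrightarrow> x0) (at_right 0)"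
    using Lim_transform_eventually by fastforce
  have y_ball: "\<forall>\<^sub>F t in at_right 0. y t \<in> ball x0 r"
    using topological_tendstoD[OF y_lim open_ball x0_ball] .
  then have y_frontier: "\<forall>\<^sub>F t in at_right 0. y t \<in> frontier U"
  proof eventually_elim
    case (elim t)
    have "g (y t) = 0"
      using g_shift[of "x0 + t *\<^sub>R h" "- g (x0 + t *\<^sub>R h)"] by (simp add: y_def)
    then show ?case using frontier_iff elim by simp
  qed
  have "\<forall>\<^sub>F t in at_right 0. (y t - x0) /\<^sub>R t \<noteq> 0"
    using tendsto_imp_eventually_ne[OF quot False] .
  then have y_ne: "\<forall>\<^sub>F t in at_right 0. y t \<noteq> x0" by eventually_elim auto
  have "filterlim y (at x0 within frontier U) (at_right 0)"
    unfolding filterlim_at using y_lim y_frontier y_ne by (auto elim: eventually_elim2)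
  then have L1: "((\<lambda>t. (\<nu> \<bullet> (y t - x0)) / norm (y t - x0)) \<longlongrightarrow> 0) (at_right 0)"
    using \<nu> unfolding is_inward_unit_normal_def by (auto intro: filterlim_compose)
  have "((\<lambda>t. (\<nu> \<bullet> ((y t - x0) /\<^sub>R t)) / norm ((y t - x0) /\<^sub>R t)) \<longlongrightarrow> (\<nu> \<bullet> h) / norm h) (at_right 0)"
    using False by (intro tendsto_intros quot) simp
  then have "((\<lambda>t. (\<nu> \<bullet> (y t - x0)) / norm (y t - x0)) \<longlongrightarrow> (\<nu> \<bullet> h) / norm h) (at_right 0)"
    by (rule Lim_transform_eventually)
      (auto intro: eventually_mono[OF eventually_at_right_less])
  with L1 have "(\<nu> \<bullet> h) / norm h = 0" using tendsto_unique[OF trivial_limit_at_right_real] by blast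
  then show ?thesis using False by simp
qed simp

text \<open>Any unit normal is a multiple of \<open>\<Gamma>\<close>, and a negative multiple points out of \<open>U\<close>. So the
  definite description in the definition of the inward normal is meaningful.\<close>

lemma inward_normal_eq: "inward_normal U x0 = \<Gamma> /\<^sub>R norm \<Gamma>"
  unfolding inward_normal_def
proof (rule the_equality, rule is_inward_unit_normal_gradient)
  fix \<nu> assume \<nu>: "is_inward_unit_normal U x0 \<nu>"
  define k where "k = (\<Gamma> \<bullet> \<nu>) / (\<Gamma> \<bullet> \<Gamma>)"
  define h where "h = \<nu> - k *\<^sub>R \<Gamma>"
  have "\<Gamma> \<bullet> h = 0" using \<Gamma>_nonzero by (simp add: h_def k_def inner_diff_right)
  moreover from this have "\<nu> \<bullet> h = 0" by (rule inward_unit_normal_orthogonal[OF \<nu>])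
  ultimately have "h \<bullet> h = 0" by (simp add: h_def inner_diff_left)
  then have \<nu>_eq: "\<nu> = k *\<^sub>R \<Gamma>" by (simp add: h_def)
  have "\<not> k < 0"
  proof
    assume "k < 0"
    then have "\<Gamma> \<bullet> \<nu> < 0" using \<Gamma>_nonzero by (simp add: \<nu>_eq mult_neg_pos)
    note eventually_not_in[OF this]
    moreover have "\<forall>\<^sub>F t in at_right 0. x0 + t *\<^sub>R \<nu> \<in> U"
      using \<nu> by (simp add: is_inward_unit_normal_def)
    ultimately have "\<forall>\<^sub>F t in at_right (0::real). False" by eventually_elim simp
    then show False by simp
  qed
  moreover have "\<bar>k\<bar> * norm \<Gamma> = 1" using \<nu> by (simp add: is_inward_unit_normal_def \<nu>_eq)
  ultimately have "k = inverse (norm \<Gamma>)" using \<Gamma>_nonzero by (simp add: field_simps)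
  then show "\<nu> = \<Gamma> /\<^sub>R norm \<Gamma>" by (simp add: \<nu>_eq)
qed

text \<open>Along a direction \<open>h\<close> with \<open>\<Gamma> \<bullet> h > 0\<close> the ray from \<open>x0\<close> enters \<open>U\<close>, and if the limiting
  directional derivative were positive, \<open>w\<close> would increase along the ray beyond its limit \<open>w0\<close>.
  A direction with \<open>\<Gamma> \<bullet> h \<ge> 0\<close>, possibly tangential, is the limit of the strictly inward directions
  \<open>h + \<delta> \<Gamma>\<close>.\<close>

lemma boundary_max_gradient:
  fixes w :: "real^'n \<Rightarrow> real"
  assumes dw: "\<And>x. x \<in> U \<Longrightarrow> (w has_derivative (\<lambda>h. D x \<bullet> h)) (at x)"
    and D_lim: "(D \<longlongrightarrow> D0) (at x0 within U)"
    and w_lim: "(w \<longlongrightarrow> w0) (at x0 within U)"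
    and w_max: "\<And>x. x \<in> U \<Longrightarrow> w x \<le> w0"
    and h: "0 \<le> h \<bullet> inward_normal U x0"
  shows "h \<bullet> D0 \<le> 0"
proof -
  have x0_out: "x0 \<notin> U" using U_iff[OF x0_ball] g_x0 by simp
  have inward: "h \<bullet> D0 \<le> 0" if pos: "0 < \<Gamma> \<bullet> h" for h
  proof (rule ccontr)
    assume "\<not> h \<bullet> D0 \<le> 0"
    define p where "p = (\<lambda>t. x0 + t *\<^sub>R h)"
    have "h \<noteq> 0" using pos by auto
    have p_in: "\<forall>\<^sub>F t in at_right 0. p t \<in> U"
      unfolding p_def by (rule eventually_in[OF pos])
    have "((\<lambda>t. x0 + t *\<^sub>R h) \<longlongrightarrow> x0 + 0 *\<^sub>R h) (at_right 0)" by (intro tendsto_intros)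
    then have p_lim: "filterlim p (at x0 within U) (at_right 0)"
      unfolding filterlim_at using p_in x0_out by (auto simp: p_def elim: eventually_mono)
    have "((\<lambda>t. h \<bullet> D (p t)) \<longlongrightarrow> h \<bullet> D0) (at_right 0)"
      by (intro tendsto_intros filterlim_compose[OF D_lim p_lim])
    then have "\<forall>\<^sub>F t in at_right 0. 0 < h \<bullet> D (p t)"
      using \<open>\<not> h \<bullet> D0 \<le> 0\<close> by (intro order_tendstoD(1)) auto
    with p_in have "\<forall>\<^sub>F t in at_right 0. p t \<in> U \<and> 0 < h \<bullet> D (p t)" by eventually_elim simp
    then obtain d where d: "0 < d" "\<And>t. 0 < t \<Longrightarrow> t < d \<Longrightarrow> p t \<in> U \<and> 0 < h \<bullet> D (p t)"
      unfolding eventually_at_right[OF zero_less_one] by auto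
    have dp: "(p has_derivative (\<lambda>s. s *\<^sub>R h)) (at t)" for t
      unfolding p_def by (auto intro!: derivative_eq_intros)
    have dwp: "((\<lambda>t. w (p t)) has_real_derivative h \<bullet> D (p t)) (at t)" if "0 < t" "t < d" for t
      using has_derivative_compose[OF dp dw] d(2)[OF that]
      by (simp add: has_field_derivative_def inner_commute mult.commute[of _ "_ \<bullet> _"])
    have incr: "w (p s) < w (p t)" if "0 < s" "s < t" "t < d" for s t
      by (rule DERIV_pos_imp_increasing[OF that(2)])
        (use dwp d(2) that in \<open>force\<close>)
    \<comment> \<open>Letting \<open>t\<close> tend to 0 gives only a weak inequality, so a second step from \<open>d/3\<close> to \<open>d/2\<close>
      makes it strict.\<close>
    have "((\<lambda>t. w (p t)) \<longlongrightarrow> w0) (at_right 0)"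
      by (rule filterlim_compose[OF w_lim p_lim])
    moreover have "\<forall>\<^sub>F t in at_right 0. w (p t) \<le> w (p (d/3))"
      unfolding eventually_at_right[OF zero_less_one]
      by (rule exI[of _ "d/3"]) (use d(1) incr[of _ "d/3"] in \<open>auto intro: less_imp_le\<close>)
    ultimately have "w0 \<le> w (p (d/3))"
      by (rule tendsto_upperbound) simp
    also have "\<dots> < w (p (d/2))" using incr d(1) by simp
    also have "\<dots> \<le> w0" using w_max d by simp
    finally show False by simp
  qed
  have h\<Gamma>: "0 \<le> \<Gamma> \<bullet> h"
    using h \<Gamma>_nonzero by (simp add: inward_normal_eq inner_commute zero_le_mult_iff)
  have "((\<lambda>\<delta>. (h + \<delta> *\<^sub>R \<Gamma>) \<bullet> D0) \<longlongrightarrow> (h + 0 *\<^sub>R \<Gamma>) \<bullet> D0) (at_right 0)"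
    by (intro tendsto_intros)
  moreover have "\<forall>\<^sub>F \<delta> in at_right 0. (h + \<delta> *\<^sub>R \<Gamma>) \<bullet> D0 \<le> 0"
    using eventually_at_right_less[of 0]
    by eventually_elim (use inward h\<Gamma> \<Gamma>_nonzero in \<open>simp add: inner_add_right add_nonneg_pos\<close>)
  ultimately show ?thesis using tendsto_upperbound[of _ "(h + 0 *\<^sub>R \<Gamma>) \<bullet> D0" "at_right (0::real)" 0] by simp
qed

end

section \<open>Touching by a quadratic function from above\<close>

text \<open>The envelope is a nested infimum and supremum in the extended reals; all later arguments use
  this description in terms of real numbers instead.\<close>

lemma usc_envelope_le_0_iff:
  "usc_envelope U u x \<le> 0 \<longleftrightarrow> (\<forall>e>0. \<exists>r>0. \<forall>y\<in>U \<inter> ball x r. u y \<le> e)"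
proof
  assume L: "usc_envelope U u x \<le> 0"
  show "\<forall>e>0. \<exists>r>0. \<forall>y\<in>U \<inter> ball x r. u y \<le> e"
  proof (intro allI impI)
    fix e :: real assume "0 < e"
    with L have "usc_envelope U u x < ereal e"
      by (metis ereal_less(2) le_less_trans)
    then obtain r where "0 < r" "(SUP y\<in>U \<inter> ball x r. ereal (u y)) < ereal e"
      unfolding usc_envelope_def INF_less_iff by auto
    then show "\<exists>r>0. \<forall>y\<in>U \<inter> ball x r. u y \<le> e"
      by (metis SUP_lessD ereal_less_eq(3) less_imp_le)
  qed
next
  assume R: "\<forall>e>0. \<exists>r>0. \<forall>y\<in>U \<inter> ball x r. u y \<le> e"
  show "usc_envelope U u x \<le> 0"
  proof (rule ereal_le_epsilon2)
    fix e :: real assume "0 < e"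
    with R obtain r where r: "0 < r" "\<forall>y\<in>U \<inter> ball x r. u y \<le> e" by blast
    have "usc_envelope U u x \<le> (SUP y\<in>U \<inter> ball x r. ereal (u y))"
      unfolding usc_envelope_def by (rule INF_lower) (use r in simp)
    also have "\<dots> \<le> ereal e" by (rule SUP_least) (use r in auto)
    finally show "usc_envelope U u x \<le> 0 + ereal e" by simp
  qed
qed

text \<open>The function \<open>u - \<epsilon> ln (1 + |x|\<^sup>2)\<close> is positive at \<open>z\<close> and tends to minus infinity at infinity,
  so a maximizing sequence stays bounded and a subsequence converges to some \<open>x0\<close>. The condition on
  the upper semicontinuous envelope prevents \<open>x0\<close> from lying on the part of the boundary outside
  \<open>D\<close>, so \<open>x0\<close> is a maximum point of the extension to \<open>U \<union> D\<close>. Finally the logarithm is concave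
  and lies below its tangent at \<open>1 + |x0|\<^sup>2\<close>; therefore the logarithmic barrier may be replaced by
  a quadratic function that touches \<open>u\<close> at the same point. The second derivatives of the logarithm
  never enter.\<close>

lemma exists_quadratic_touching_point:
  fixes u v :: "real^'n \<Rightarrow> real"
  assumes bound: "\<And>x. x \<in> U \<Longrightarrow> u x \<le> S" and \<epsilon>: "0 < \<epsilon>"
    and v: "continuous_on (U \<union> D) v" "\<And>x. x \<in> U \<Longrightarrow> v x = u x"
    and env: "\<And>x. x \<in> frontier U - D \<Longrightarrow> usc_envelope U u x \<le> 0"
    and z: "z \<in> U" "0 < u z - \<epsilon> * ln (1 + (norm z)\<^sup>2)"
  obtains x0 where "x0 \<in> U \<union> D" "u z - \<epsilon> * ln (1 + (norm z)\<^sup>2) \<le> v x0"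
    "\<And>x. x \<in> U \<Longrightarrow>
      u x \<le> v x0 + (2 * \<epsilon> / (1 + (norm x0)\<^sup>2)) / 2 * ((norm x)\<^sup>2 - (norm x0)\<^sup>2)"
proof -
  define L where "L = (\<lambda>x::real^'n. ln (1 + (norm x)\<^sup>2))"
  define w where "w = (\<lambda>x. u x - \<epsilon> * L x)"
  define s where "s = (SUP x\<in>U. w x)"
  have pos: "0 < 1 + (norm x)\<^sup>2" for x :: "real^'n" by (simp add: add_pos_nonneg)
  have L0: "0 \<le> L x" for x unfolding L_def by simp
  have wu: "w x \<le> u x" for x using L0[of x] \<epsilon> by (simp add: w_def)
  have bdd: "bdd_above (w ` U)"
    using bound wu by (intro bdd_aboveI2[of _ _ S]) (blast intro: order_trans)
  have ws: "w x \<le> s" if "x \<in> U" for x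
    unfolding s_def using bdd that by (rule cSUP_upper[rotated])
  have s_pos: "0 < s" using ws[OF z(1)] z(2) by (simp add: w_def L_def)
  have "\<exists>x\<in>U. s - inverse (real (Suc n)) < w x" for n
    using less_cSUP_iff[OF _ bdd, of "s - inverse (real (Suc n))"] z(1) by (auto simp: s_def)
  then obtain X where X: "\<And>n. X n \<in> U" "\<And>n. s - inverse (real (Suc n)) < w (X n)"
    by metis
  have "(\<lambda>n. s - inverse (real (Suc n))) \<longlonglongrightarrow> s - 0"
    by (intro tendsto_intros LIMSEQ_inverse_real_of_nat)
  then have low: "(\<lambda>n. s - inverse (real (Suc n))) \<longlonglongrightarrow> s" by simp
  have wX: "(\<lambda>n. w (X n)) \<longlonglongrightarrow> s"
    by (rule tendsto_sandwich[OF _ _ low tendsto_const])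
      (use X ws in \<open>auto intro!: always_eventually less_imp_le\<close>)
  \<comment> \<open>Along the sequence \<open>w\<close> is bounded below and \<open>u\<close> above, which bounds the logarithm.\<close>
  have "norm (X n) \<le> sqrt (exp ((S - s + 1) / \<epsilon>))" for n
  proof -
    have "s - 1 < w (X n)"
      using X(2)[of n] by (smt (verit) inverse_le_1_iff of_nat_Suc of_nat_0_le_iff)
    then have "\<epsilon> * L (X n) \<le> S - s + 1" using bound[OF X(1)[of n]] by (simp add: w_def)
    then have "L (X n) \<le> (S - s + 1) / \<epsilon>" using \<epsilon> by (simp add: pos_le_divide_eq mult.commute)
    then have "1 + (norm (X n))\<^sup>2 \<le> exp ((S - s + 1) / \<epsilon>)"
      unfolding L_def using pos by (metis exp_le_cancel_iff exp_ln)
    then show ?thesis by (intro real_le_rsqrt) simp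
  qed
  then have "bounded (range X)" by (auto simp: bounded_iff)
  then obtain x0 \<rho> where \<rho>: "strict_mono (\<rho> :: nat \<Rightarrow> nat)" "(X \<circ> \<rho>) \<longlonglongrightarrow> x0"
    using bounded_imp_convergent_subsequence by blast
  have w\<rho>: "(\<lambda>n. w (X (\<rho> n))) \<longlonglongrightarrow> s"
    using LIMSEQ_subseq_LIMSEQ[OF wX \<rho>(1)] by (simp add: o_def)
  have X\<rho>: "(\<lambda>n. X (\<rho> n)) \<longlonglongrightarrow> x0" using \<rho>(2) by (simp add: o_def)
  have x0_cl: "x0 \<in> closure U"
    unfolding closure_sequential
    by (intro exI[of _ "\<lambda>n. X (\<rho> n)"]) (use X\<rho> X(1) in simp)
  have x0_in: "x0 \<in> U \<union> D"
  proof (rule ccontr)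
    assume "x0 \<notin> U \<union> D"
    then have "x0 \<in> frontier U - D"
      using x0_cl interior_subset by (auto simp: frontier_def)
    with env have "usc_envelope U u x0 \<le> 0" .
    then obtain r where r: "0 < r" "\<forall>y\<in>U \<inter> ball x0 r. u y \<le> s / 2"
      using s_pos unfolding usc_envelope_le_0_iff by (meson half_gt_zero)
    have "\<forall>\<^sub>F n in sequentially. X (\<rho> n) \<in> ball x0 r"
      using topological_tendstoD[OF X\<rho> open_ball] r(1) by simp
    then have "\<forall>\<^sub>F n in sequentially. w (X (\<rho> n)) \<le> s / 2"
    proof eventually_elim
      case (elim n)
      have "u (X (\<rho> n)) \<le> s / 2" using r(2) X(1) elim by blast
      with wu[of "X (\<rho> n)"] show ?case by linarith
    qed
    then have "s \<le> s / 2" by (rule tendsto_upperbound[OF w\<rho>]) simp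
    with s_pos show False by simp
  qed
  have "(\<lambda>n. v (X (\<rho> n))) \<longlonglongrightarrow> v x0"
    by (rule continuous_on_tendsto_compose[OF v(1) X\<rho> x0_in]) (use X(1) in auto)
  moreover have "(\<lambda>n. \<epsilon> * L (X (\<rho> n))) \<longlonglongrightarrow> \<epsilon> * L x0"
    unfolding L_def using pos[of x0] by (intro tendsto_intros X\<rho>) auto
  ultimately have "(\<lambda>n. v (X (\<rho> n)) - \<epsilon> * L (X (\<rho> n))) \<longlonglongrightarrow> v x0 - \<epsilon> * L x0"
    by (rule tendsto_diff)
  then have "(\<lambda>n. w (X (\<rho> n))) \<longlonglongrightarrow> v x0 - \<epsilon> * L x0"
    by (simp add: w_def v(2) X(1))
  with w\<rho> have s_eq: "s = v x0 - \<epsilon> * L x0" using LIMSEQ_unique by blast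
  show ?thesis
  proof (rule that[OF x0_in])
    have "0 \<le> \<epsilon> * L x0" using \<epsilon> L0 by simp
    then show "u z - \<epsilon> * ln (1 + (norm z)\<^sup>2) \<le> v x0"
      using ws[OF z(1)] by (simp add: s_eq w_def L_def)
  next
    fix x assume x: "x \<in> U"
    let ?p = "1 + (norm x)\<^sup>2" and ?q = "1 + (norm x0)\<^sup>2"
    have "L x - L x0 = ln (?p / ?q)" 
      unfolding L_def using pos[of x] pos[of x0] by (simp add: ln_divide_pos)
    also have "\<dots> \<le> ?p / ?q - 1" by (rule ln_le_minus_one) (use pos in simp)
    also have "\<dots> = ((norm x)\<^sup>2 - (norm x0)\<^sup>2) / ?q" using pos[of x0] by (simp add: field_simps)
    finally have "\<epsilon> * (L x - L x0) \<le> \<epsilon> * (((norm x)\<^sup>2 - (norm x0)\<^sup>2) / ?q)"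
      by (rule mult_left_mono) (use \<epsilon> in simp)
    moreover have "u x \<le> v x0 + \<epsilon> * (L x - L x0)"
      using ws[OF x] by (simp add: s_eq w_def algebra_simps)
    moreover have "(2 * \<epsilon> / q) / 2 * d = \<epsilon> * (d / q)" for q d :: real by simp
    ultimately show "u x \<le> v x0 + (2 * \<epsilon> / ?q) / 2 * ((norm x)\<^sup>2 - (norm x0)\<^sup>2)"
      by (metis (no_types, lifting) add_left_mono order_trans)
  qed
qed

text \<open>At the touching point the gradient of \<open>u\<close> is \<open>k x0\<close> and the Hessian is at most \<open>k\<close> times the
  identity.\<close>

lemma elliptic_op_touching_interior:
  assumes U: "open U" "x0 \<in> U" and u: "u \<in> C2 U" and a: "sym_nonneg (a x0)"
    and touch: "\<forall>x\<in>U. u x \<le> u x0 + k / 2 * ((norm x)\<^sup>2 - (norm x0)\<^sup>2)"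
  shows "c x0 * u x0 \<le> elliptic_op a b c u x0 + k * (trace (a x0) + b x0 \<bullet> x0)"
proof -
  define H where "H = hessian u x0"
  have tr: "trace (a x0 ** (H - k *\<^sub>R mat 1)) = trace (a x0 ** H) - k * trace (a x0)"
  proof -
    have "trace (a x0 ** (H - k *\<^sub>R mat 1))
        = (\<Sum>i\<in>UNIV. \<Sum>j\<in>UNIV. a x0 $ i $ j * H $ j $ i - (if j = i then k * a x0 $ i $ i else 0))"
      unfolding trace_def matrix_matrix_mult_def
      by (auto simp: mat_def right_diff_distrib intro!: sum.cong)
    then show ?thesis
      by (simp add: sum_subtractf trace_def matrix_matrix_mult_def sum_distrib_left)
  qed
  have "trace (a x0 ** (H - k *\<^sub>R mat 1)) \<le> 0"
  proof (rule sym_nonneg_trace_mult_nonpos[OF a])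
    fix h
    have "(H - k *\<^sub>R mat 1) *v h = H *v h - k *\<^sub>R h"
      by (simp add: matrix_vector_mult_diff_rdistrib flip: scaleR_matrix_vector_assoc)
    then show "h \<bullet> ((H - k *\<^sub>R mat 1) *v h) \<le> 0"
      using quadratic_touching_interior(2)[OF U u touch, of h] by (simp add: H_def inner_diff_right)
  qed
  then have "trace (a x0 ** H) \<le> k * trace (a x0)" using tr by simp
  moreover have "grad u x0 = k *\<^sub>R x0" by (rule quadratic_touching_interior(1)[OF U u touch])
  ultimately show ?thesis
    by (simp add: elliptic_op_def distrib_left flip: H_def)
qed

text \<open>At a degenerate boundary point the Hessian of \<open>u\<close> may blow up, so the operator is not evaluated at
  \<open>x0\<close>. Instead the inequality \<open>elliptic_op a b c u \<le> M\<close> is passed to the limit from inside \<open>U\<close>,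
  where the second order term disappears. The coefficient \<open>c\<close> has no limit in general and is
  first replaced by its lower bound, which is legitimate near \<open>x0\<close> because \<open>u\<close> is positive there.
  The sign of the first order term comes from the maximum principle of first order at the boundary.\<close>

lemma elliptic_op_touching_boundary:
  fixes u v :: "real^'n \<Rightarrow> real"
  assumes U: "open U" "x0 \<in> frontier U" "C1_holder_boundary \<alpha> U T" "x0 \<in> T"
    and du: "\<And>x. x \<in> U \<Longrightarrow> u differentiable (at x)"
    and lim_u: "(u \<longlongrightarrow> u0) (at x0 within U)"
    and lim_grad: "(grad u \<longlongrightarrow> D0) (at x0 within U)"
    and lim_tr: "((\<lambda>x. trace (a x ** hessian u x)) \<longlongrightarrow> 0) (at x0 within U)"
    and lim_b: "(b \<longlongrightarrow> b x0) (at x0 within U)"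
    and b: "0 \<le> b x0 \<bullet> inward_normal U x0"
    and c: "\<And>x. x \<in> U \<Longrightarrow> c0 \<le> c x" and u0: "0 < u0"
    and M: "\<And>x. x \<in> U \<Longrightarrow> elliptic_op a b c u x \<le> M"
    and touch: "\<And>x. x \<in> U \<Longrightarrow> u x \<le> u0 + k / 2 * ((norm x)\<^sup>2 - (norm x0)\<^sup>2)"
  shows "c0 * u0 \<le> M + k * (b x0 \<bullet> x0)"
proof -
  obtain e \<Gamma> r g where "graph_chart U x0 e \<Gamma> r g"
    using C1_holder_boundary_graph_chart[OF U(3,4,2)] .
  then interpret graph_chart U x0 e \<Gamma> r g .
  have "b x0 \<bullet> (D0 - k *\<^sub>R x0) \<le> 0"
  proof (rule boundary_max_gradient[OF _ _ _ _ b])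
    show "((\<lambda>x. u x - k / 2 * (x \<bullet> x)) has_derivative (\<lambda>h. (grad u x - k *\<^sub>R x) \<bullet> h)) (at x)"
      if "x \<in> U" for x
      using du[OF that] by (auto intro!: derivative_eq_intros has_derivative_grad)
        (simp add: algebra_simps inner_commute)
    show "((\<lambda>x. grad u x - k *\<^sub>R x) \<longlongrightarrow> D0 - k *\<^sub>R x0) (at x0 within U)"
      by (intro tendsto_intros lim_grad)
    show "((\<lambda>x. u x - k / 2 * (x \<bullet> x)) \<longlongrightarrow> u0 - k / 2 * (x0 \<bullet> x0)) (at x0 within U)"
      by (intro tendsto_intros lim_u)
    show "u x - k / 2 * (x \<bullet> x) \<le> u0 - k / 2 * (x0 \<bullet> x0)" if "x \<in> U" for x
      using touch[OF that] by (simp add: power2_norm_eq_inner algebra_simps)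
  qed
  moreover have "- 0 - b x0 \<bullet> D0 + c0 * u0 \<le> M"
  proof (rule tendsto_upperbound)
    show "((\<lambda>x. - trace (a x ** hessian u x) - b x \<bullet> grad u x + c0 * u x)
        \<longlongrightarrow> - 0 - b x0 \<bullet> D0 + c0 * u0) (at x0 within U)"
      by (intro tendsto_intros lim_tr lim_b lim_grad lim_u)
    have "\<forall>\<^sub>F x in at x0 within U. x \<in> U" by (simp add: eventually_at_filter)
    with order_tendstoD(1)[OF lim_u u0]
    show "\<forall>\<^sub>F x in at x0 within U. - trace (a x ** hessian u x) - b x \<bullet> grad u x + c0 * u x \<le> M"
    proof eventually_elim
      case (elim x)
      then have "c0 * u x \<le> c x * u x" using c by (simp add: mult_right_mono)
      with M[OF elim(2)] show ?case by (simp add: elliptic_op_def)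
    qed
    have "x0 \<notin> U" using U(1,2) by (simp add: frontier_def interior_open)
    then show "at x0 within U \<noteq> bot"
      using U(2) by (simp add: at_within_eq_bot_iff frontier_def)
  qed
  ultimately show ?thesis by (simp add: inner_diff_right)
qed

section \<open>The convex cone of test functions\<close>

lemma grad_hessian_linear_combination:
  fixes u v :: "real^'n \<Rightarrow> real"
    and s t :: real
  assumes U: "open U" and u: "u \<in> C2 U" and v: "v \<in> C2 U"
  defines "w \<equiv> \<lambda>x. s * u x + t * v x"
  shows "\<And>x. x \<in> U \<Longrightarrow> grad w x = s *\<^sub>R grad u x + t *\<^sub>R grad v x"
    and "\<And>x. x \<in> U \<Longrightarrow> hessian w x = s *\<^sub>R hessian u x + t *\<^sub>R hessian v x"
    and "w \<in> C2 U"
proof -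
  have dw: "(w has_derivative (\<lambda>h. (s *\<^sub>R grad u x + t *\<^sub>R grad v x) \<bullet> h)) (at x)" if "x \<in> U" for x
    unfolding w_def using u v that
    by (auto simp: C2_def intro!: derivative_eq_intros has_derivative_grad)
      (simp add: algebra_simps)
  then show g: "grad w x = s *\<^sub>R grad u x + t *\<^sub>R grad v x" if "x \<in> U" for x
    using that by (intro grad_eqI)
  have dg: "(grad w has_derivative (\<lambda>h. (s *\<^sub>R hessian u x + t *\<^sub>R hessian v x) *v h)) (at x)"
    if "x \<in> U" for x
  proof (rule has_derivative_transform_within_open[OF _ U that])
    have "((\<lambda>x. s *\<^sub>R grad u x + t *\<^sub>R grad v x) has_derivative
        (\<lambda>h. s *\<^sub>R (hessian u x *v h) + t *\<^sub>R (hessian v x *v h))) (at x)"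
      using u v that by (intro derivative_intros has_derivative_hessian) (auto simp: C2_def)
    then show "((\<lambda>x. s *\<^sub>R grad u x + t *\<^sub>R grad v x) has_derivative
        (\<lambda>h. (s *\<^sub>R hessian u x + t *\<^sub>R hessian v x) *v h)) (at x)"
      by (simp add: matrix_vector_mult_add_rdistrib scaleR_matrix_vector_assoc)
  qed (use g in auto)
  then show h: "hessian w x = s *\<^sub>R hessian u x + t *\<^sub>R hessian v x" if "x \<in> U" for x
    using that by (intro hessian_eqI)
  have "continuous_on U (\<lambda>x. s *\<^sub>R hessian u x + t *\<^sub>R hessian v x)"
    using u v by (intro continuous_intros) (auto simp: C2_def)
  then have "continuous_on U (hessian w)" using h by (simp cong: continuous_on_cong)
  then show "w \<in> C2 U"
    using dw dg unfolding C2_def differentiable_def by blast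
qed

text \<open>The cone property needs only sums and nonnegative multiples, both of which are special cases.\<close>

lemma C2s_linear_combination:
  fixes u v :: "real^'n \<Rightarrow> real"
  assumes U: "open U" and u: "u \<in> C2s U a" and v: "v \<in> C2s U a"
  shows "(\<lambda>x. s * u x + t * v x) \<in> C2s U a"
proof -
  define w where "w = (\<lambda>x. s * u x + t * v x)"
  let ?S = "with_deg_boundary U a"
  have uv: "u \<in> C2 U" "v \<in> C2 U" using u v by (auto simp: C2s_def)
  note gh = grad_hessian_linear_combination[OF U uv, where s = s and t = t, folded w_def]
  obtain u' Gu gu where u': "continuous_on ?S u'" "\<forall>x\<in>U. u' x = u x"
      "continuous_on ?S Gu" "\<forall>x\<in>U. Gu x = grad u x"
      "continuous_on ?S gu" "\<forall>x\<in>U. gu x = trace (a x ** hessian u x)" "\<forall>x\<in>deg_boundary U a. gu x = 0"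
    using u unfolding C2s_def C1_up_to_def by blast
  obtain v' Gv gv where v': "continuous_on ?S v'" "\<forall>x\<in>U. v' x = v x"
      "continuous_on ?S Gv" "\<forall>x\<in>U. Gv x = grad v x"
      "continuous_on ?S gv" "\<forall>x\<in>U. gv x = trace (a x ** hessian v x)" "\<forall>x\<in>deg_boundary U a. gv x = 0"
    using v unfolding C2s_def C1_up_to_def by blast
  have "w \<in> C1_up_to U ?S"
    unfolding C1_up_to_def
  proof (intro CollectI conjI)
    show "\<forall>x\<in>U. w differentiable (at x)" using gh(3) by (auto simp: C2_def)
    show "\<exists>v. continuous_on ?S v \<and> (\<forall>x\<in>U. v x = w x)"
      by (rule exI[of _ "\<lambda>x. s * u' x + t * v' x"])
        (use u' v' in \<open>auto simp: w_def intro!: continuous_intros\<close>)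
    show "\<exists>G. continuous_on ?S G \<and> (\<forall>x\<in>U. G x = grad w x)"
      by (rule exI[of _ "\<lambda>x. s *\<^sub>R Gu x + t *\<^sub>R Gv x"])
        (use u' v' gh(1) in \<open>auto intro!: continuous_intros\<close>)
  qed
  moreover have "\<exists>g. continuous_on ?S g \<and> (\<forall>x\<in>U. g x = trace (a x ** hessian w x)) \<and>
      (\<forall>x\<in>deg_boundary U a. g x = 0)"
  proof (rule exI[of _ "\<lambda>x. s * gu x + t * gv x"], intro conjI ballI)
    show "continuous_on ?S (\<lambda>x. s * gu x + t * gv x)" using u' v' by (intro continuous_intros)
    show "s * gu x + t * gv x = 0" if "x \<in> deg_boundary U a" for x using u' v' that by simp
    show "s * gu x + t * gv x = trace (a x ** hessian w x)" if "x \<in> U" for x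
      using u' v' that
      by (simp add: gh(2) trace_def matrix_matrix_mult_def sum_distrib_left sum.distrib
          algebra_simps)
  qed
  ultimately show ?thesis using gh(3) by (simp add: C2s_def w_def)
qed

lemma zero_mem_C2s: "(\<lambda>_. 0) \<in> C2s U a"
proof -
  have g: "grad (\<lambda>_. 0) = (\<lambda>_::real^'n. 0)"
    by (intro ext grad_eqI) simp
  have h: "hessian (\<lambda>_. 0) = (\<lambda>_::real^'n. 0)"
    by (intro ext hessian_eqI) (simp add: g)
  show ?thesis
    by (auto simp: C2s_def C2_def C1_up_to_def g h trace_def matrix_matrix_mult_def
        intro!: exI[of _ "\<lambda>_. 0"])
qed

lemma usc_envelope_linear_combination_le_0:
  assumes "usc_envelope U u x \<le> 0" "usc_envelope U v x \<le> 0" "0 \<le> s" "0 \<le> t"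
  shows "usc_envelope U (\<lambda>y. s * u y + t * v y) x \<le> 0"
  unfolding usc_envelope_le_0_iff
proof (intro allI impI)
  fix e :: real assume e: "0 < e"
  define d where "d = e / (s + t + 1)"
  have d: "0 < d" "(s + t) * d \<le> e" using assms(3,4) e by (auto simp: d_def field_simps)
  obtain r1 where r1: "0 < r1" "\<forall>y\<in>U \<inter> ball x r1. u y \<le> d"
    using assms(1) d(1) unfolding usc_envelope_le_0_iff by blast
  obtain r2 where r2: "0 < r2" "\<forall>y\<in>U \<inter> ball x r2. v y \<le> d"
    using assms(2) d(1) unfolding usc_envelope_le_0_iff by blast
  have "s * u y + t * v y \<le> e" if "y \<in> U \<inter> ball x (min r1 r2)" for y
  proof -
    have "s * u y + t * v y \<le> s * d + t * d"
      using that r1 r2 assms(3,4) by (intro add_mono mult_left_mono) auto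
    with d(2) show ?thesis by (simp add: algebra_simps)
  qed
  then show "\<exists>r>0. \<forall>y\<in>U \<inter> ball x r. s * u y + t * v y \<le> e"
    using r1 r2 by (intro exI[of _ "min r1 r2"]) auto
qed

lemma SUP_ereal_less_PInf_iff:
  fixes u :: "'a \<Rightarrow> real"
  shows "(SUP x\<in>A. ereal (u x)) < \<infinity> \<longleftrightarrow> (\<exists>S. \<forall>x\<in>A. u x \<le> S)"
proof
  assume lt: "(SUP x\<in>A. ereal (u x)) < \<infinity>"
  then obtain S where "(SUP x\<in>A. ereal (u x)) < ereal S" using less_PInf_Ex_of_nat by fastforce
  then show "\<exists>S. \<forall>x\<in>A. u x \<le> S" by (metis SUP_lessD ereal_less_eq(3) less_imp_le)
next
  assume "\<exists>S. \<forall>x\<in>A. u x \<le> S"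
  then obtain S where "\<forall>x\<in>A. u x \<le> S" ..
  then have "(SUP x\<in>A. ereal (u x)) \<le> ereal S" by (intro SUP_least) simp
  then show "(SUP x\<in>A. ereal (u x)) < \<infinity>" by (auto intro: le_less_trans)
qed

section \<open>The maximum principle\<close>

lemma deg_boundary_subset_frontier: "deg_boundary U a \<subseteq> frontier U"
  unfolding deg_boundary_def
  by (metis (no_types, lifting) interior_of_subset_topspace topspace_euclidean_subtopology)

text \<open>At the touching point the quadratic function has coefficient \<open>k = 2 \<epsilon> / (1 + |x0|\<^sup>2)\<close>, which is
  chosen so that the growth condition bounds its contribution to the operator by \<open>2 \<epsilon> K\<close>, wherever
  \<open>x0\<close> may lie. Letting \<open>\<epsilon>\<close> tend to zero gives the claim.\<close>

lemma maximum_principle_bound: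
  fixes U :: "(real^'n) set"
  assumes U: "open U"
    and a_nonneg: "\<forall>x\<in>U. sym_nonneg (a x)"
    and a_boundary: "\<forall>x\<in>deg_boundary U a. a x = 0"
    and b_boundary: "\<forall>x\<in>deg_boundary U a. (b \<longlongrightarrow> b x) (at x within U)"
    and smooth_boundary: "C1_holder_boundary \<alpha> U (deg_boundary U a)"
    and b_perp: "\<forall>x\<in>deg_boundary U a. 0 \<le> b x \<bullet> inward_normal U x"
    and c_lower: "0 < c0" "\<forall>x\<in>U. c0 \<le> c x"
    and growth: "\<forall>x\<in>with_deg_boundary U a. trace (a x) + b x \<bullet> x \<le> K * (1 + (norm x)\<^sup>2)"
    and u: "u \<in> C2s U a"
    and bound: "\<forall>x\<in>U. u x \<le> S"
    and env: "\<forall>x\<in>frontier U - deg_boundary U a. usc_envelope U u x \<le> 0"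
    and M: "\<forall>x\<in>U. elliptic_op a b c u x \<le> M"
    and z: "z \<in> U" "0 < u z"
  shows "c0 * u z \<le> M"
proof -
  let ?D = "deg_boundary U a"
  have S_eq: "with_deg_boundary U a = U \<union> ?D" by (simp add: with_deg_boundary_def)
  obtain v G g where ext: "continuous_on (U \<union> ?D) v" "\<forall>x\<in>U. v x = u x"
      "continuous_on (U \<union> ?D) G" "\<forall>x\<in>U. G x = grad u x"
      "continuous_on (U \<union> ?D) g" "\<forall>x\<in>U. g x = trace (a x ** hessian u x)" "\<forall>x\<in>?D. g x = 0"
    using u unfolding C2s_def C1_up_to_def S_eq by blast
  have u2: "u \<in> C2 U" using u by (simp add: C2s_def)
  have lim: "(f \<longlongrightarrow> F x0) (at x0 within U)"
    if "continuous_on (U \<union> ?D) F" "\<forall>x\<in>U. F x = f x" "x0 \<in> ?D"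
    for x0 and f F :: "real^'n \<Rightarrow> 'b::topological_space"
  proof -
    have "(F \<longlongrightarrow> F x0) (at x0 within U)"
      using that(1,3) unfolding continuous_on_def by (meson UnI2 Un_upper1 tendsto_within_subset)
    moreover have "\<forall>\<^sub>F x in at x0 within U. F x = f x"
      using that(2) by (simp add: eventually_at_filter)
    ultimately show ?thesis by (rule Lim_transform_eventually)
  qed
  define L where "L = ln (1 + (norm z)\<^sup>2)"
  have step: "c0 * (u z - \<epsilon> * L) \<le> M + 2 * \<epsilon> * K" if \<epsilon>: "0 < \<epsilon>" "0 < u z - \<epsilon> * L" for \<epsilon>
  proof -
    obtain x0 where x0: "x0 \<in> U \<union> ?D" "u z - \<epsilon> * L \<le> v x0"
      and touch: "\<And>x. x \<in> U \<Longrightarrow>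
        u x \<le> v x0 + (2 * \<epsilon> / (1 + (norm x0)\<^sup>2)) / 2 * ((norm x)\<^sup>2 - (norm x0)\<^sup>2)"
      using exists_quadratic_touching_point[of U u S \<epsilon> ?D v z] bound \<epsilon> ext(1,2) env z(1)
      unfolding L_def by blast
    define k where "k = 2 * \<epsilon> / (1 + (norm x0)\<^sup>2)"
    note touch = touch[folded k_def]
    have pos: "0 < 1 + (norm x0)\<^sup>2" by (simp add: add_pos_nonneg)
    have k0: "0 \<le> k" using \<epsilon>(1) pos by (simp add: k_def)
    have v0: "0 < v x0" using x0(2) \<epsilon>(2) by simp
    have "c0 * v x0 \<le> M + k * (trace (a x0) + b x0 \<bullet> x0)"
    proof (cases "x0 \<in> U")
      case True
      then have vx0: "v x0 = u x0" using ext(2) by simp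
      have "c x0 * u x0 \<le> elliptic_op a b c u x0 + k * (trace (a x0) + b x0 \<bullet> x0)"
        using elliptic_op_touching_interior[OF U True u2] a_nonneg True touch vx0 by simp
      moreover have "c0 * u x0 \<le> c x0 * u x0"
        using c_lower(2) True v0 vx0 by (simp add: mult_right_mono)
      ultimately show ?thesis using M True vx0 by fastforce
    next
      case False
      then have D: "x0 \<in> ?D" using x0(1) by simp
      have "c0 * v x0 \<le> M + k * (b x0 \<bullet> x0)"
      proof (rule elliptic_op_touching_boundary[where c = c, OF U _ smooth_boundary D])
        show "x0 \<in> frontier U" using D deg_boundary_subset_frontier by blast
        show "u differentiable (at x)" if "x \<in> U" for x using u2 that by (simp add: C2_def)
        show "(u \<longlongrightarrow> v x0) (at x0 within U)" by (rule lim[OF ext(1,2) D])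
        show "(grad u \<longlongrightarrow> G x0) (at x0 within U)" by (rule lim[OF ext(3,4) D])
        show "((\<lambda>x. trace (a x ** hessian u x)) \<longlongrightarrow> 0) (at x0 within U)"
          using lim[OF ext(5,6) D] ext(7) D by simp
        show "(b \<longlongrightarrow> b x0) (at x0 within U)" "0 \<le> b x0 \<bullet> inward_normal U x0"
          using b_boundary b_perp D by auto
        show "0 < v x0" by (rule v0)
      qed (use c_lower(2) M touch in auto)
      then show ?thesis using a_boundary D by (simp add: trace_def)
    qed
    also have "k * (trace (a x0) + b x0 \<bullet> x0) \<le> k * (K * (1 + (norm x0)\<^sup>2))"
      using growth x0(1) k0 unfolding S_eq by (intro mult_left_mono) blast+
    also have "k * (K * (1 + (norm x0)\<^sup>2)) = 2 * \<epsilon> * K" using pos by (simp add: k_def)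
    finally have "c0 * v x0 \<le> M + 2 * \<epsilon> * K" by simp
    moreover have "c0 * (u z - \<epsilon> * L) \<le> c0 * v x0" using x0(2) c_lower(1) by simp
    ultimately show ?thesis by linarith
  qed
  have lim_L: "((\<lambda>\<epsilon>. u z - \<epsilon> * L) \<longlongrightarrow> u z - 0 * L) (at_right 0)" by (intro tendsto_intros)
  have "\<forall>\<^sub>F \<epsilon> in at_right 0. 0 < u z - \<epsilon> * L"
    using order_tendstoD(1)[OF lim_L, of 0] z(2) by simp
  then have ev: "\<forall>\<^sub>F \<epsilon> in at_right 0. c0 * (u z - \<epsilon> * L) \<le> M + 2 * \<epsilon> * K"
    using eventually_at_right_less[of 0] by eventually_elim (rule step)
  have lim_l: "((\<lambda>\<epsilon>. c0 * (u z - \<epsilon> * L)) \<longlongrightarrow> c0 * (u z - 0 * L)) (at_right 0)"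
    by (intro tendsto_intros)
  have lim_r: "((\<lambda>\<epsilon>. M + 2 * \<epsilon> * K) \<longlongrightarrow> M + 2 * 0 * K) (at_right 0)"
    by (intro tendsto_intros)
  show ?thesis using tendsto_le[OF _ lim_r lim_l ev] by simp
qed

theorem theorem5p4:
  fixes U :: "(real^'n) set"
    and a :: "real^'n \<Rightarrow> real^'n^'n" and b :: "real^'n \<Rightarrow> real^'n" and c :: "real^'n \<Rightarrow> real"
    and \<alpha> c0 K :: real
  assumes "open U"
    and a_nonneg: "\<forall>x\<in>U. sym_nonneg (a x)"
    and a_boundary: "\<forall>x\<in>deg_boundary U a. a x = 0"
    and b_boundary: "\<forall>x\<in>deg_boundary U a. (b \<longlongrightarrow> b x) (at x within U)"
    and alpha: "0 < \<alpha>" "\<alpha> < 1"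
    and smooth_boundary: "C1_holder_boundary \<alpha> U (deg_boundary U a)"
    and b_perp: "\<forall>x\<in>deg_boundary U a. 0 \<le> b x \<bullet> inward_normal U x"
    and c_lower: "0 < c0" "\<forall>x\<in>U. c0 \<le> c x"
    and c_boundary: "\<forall>x\<in>deg_boundary U a. 0 < c x"
    and growth: "0 < K"
      "\<forall>x\<in>with_deg_boundary U a. trace (a x) + b x \<bullet> x \<le> K * (1 + (norm x)\<^sup>2)"
  shows "(\<forall>u\<in>C2s U a.
            (SUP x\<in>U. ereal (u x)) < \<infinity> \<longrightarrow>
            (\<forall>x\<in>frontier U - deg_boundary U a. usc_envelope U u x \<le> 0) \<longrightarrow>
            (SUP x\<in>U. ereal (u x))
              \<le> max 0 (ereal (1 / c0) * (SUP x\<in>U. ereal (elliptic_op a b c u x))))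
       \<and> weak_max_principle_property U (deg_boundary U a) (elliptic_op a b c)
            {u \<in> C2s U a. (SUP x\<in>U. ereal (u x)) < \<infinity> \<and>
               (\<forall>x\<in>closure (deg_boundary U a) - deg_boundary U a. usc_envelope U u x \<le> 0)}"
proof (intro conjI)
  let ?D = "deg_boundary U a"
  let ?A = "elliptic_op a b c"
  note bound = maximum_principle_bound[OF \<open>open U\<close> a_nonneg a_boundary b_boundary smooth_boundary
      b_perp c_lower growth(2)]
  show "\<forall>u\<in>C2s U a.
            (SUP x\<in>U. ereal (u x)) < \<infinity> \<longrightarrow>
            (\<forall>x\<in>frontier U - ?D. usc_envelope U u x \<le> 0) \<longrightarrow>
            (SUP x\<in>U. ereal (u x)) \<le> max 0 (ereal (1 / c0) * (SUP x\<in>U. ereal (?A u x)))"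
  proof (intro ballI impI SUP_least)
    fix u z
    assume u: "u \<in> C2s U a" "(SUP x\<in>U. ereal (u x)) < \<infinity>"
      "\<forall>x\<in>frontier U - ?D. usc_envelope U u x \<le> 0" and z: "z \<in> U"
    obtain S where S: "\<forall>x\<in>U. u x \<le> S" using u(2) unfolding SUP_ereal_less_PInf_iff by blast
    let ?s = "SUP x\<in>U. ereal (?A u x)"
    have le: "ereal (?A u x) \<le> ?s" if "x \<in> U" for x using that by (rule SUP_upper)
    show "ereal (u z) \<le> max 0 (ereal (1 / c0) * ?s)"
    proof (cases "0 < u z")
      case False
      then show ?thesis by (simp add: max.coboundedI1)
    next
      case uz: True
      show ?thesis
      proof (cases ?s)
        case (real M)
        then have "\<forall>x\<in>U. ?A u x \<le> M" using le by (metis ereal_less_eq(3))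
        from bound[OF u(1) S u(3) this z uz] have "u z \<le> 1 / c0 * M"
          using c_lower(1) by (simp add: field_simps)
        then have "ereal (u z) \<le> ereal (1 / c0) * ?s" by (simp add: real)
        then show ?thesis by (rule max.coboundedI2)
      next
        case PInf
        then show ?thesis using c_lower(1) by simp
      next
        case MInf
        then show ?thesis using le[OF z] by simp
      qed
    qed
  qed
  let ?C = "{u \<in> C2s U a. (SUP x\<in>U. ereal (u x)) < \<infinity> \<and>
               (\<forall>x\<in>closure ?D - ?D. usc_envelope U u x \<le> 0)}"
  have comb: "(\<lambda>x. s * u x + t * v x) \<in> ?C" if uv: "u \<in> ?C" "v \<in> ?C" and st: "0 \<le> s" "0 \<le> t" for u v s t
  proof -
    obtain S T where ST: "\<forall>x\<in>U. u x \<le> S" "\<forall>x\<in>U. v x \<le> T"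
      using uv unfolding SUP_ereal_less_PInf_iff mem_Collect_eq by blast
    have "\<forall>x\<in>U. s * u x + t * v x \<le> s * S + t * T"
      using ST st by (auto intro!: add_mono mult_left_mono)
    then have "(SUP x\<in>U. ereal (s * u x + t * v x)) < \<infinity>"
      unfolding SUP_ereal_less_PInf_iff by blast
    moreover have "(\<lambda>x. s * u x + t * v x) \<in> C2s U a"
      using C2s_linear_combination[OF \<open>open U\<close>] uv by blast
    moreover have "\<forall>x\<in>closure ?D - ?D. usc_envelope U (\<lambda>x. s * u x + t * v x) x \<le> 0"
      using usc_envelope_linear_combination_le_0[OF _ _ st] uv by blast
    ultimately show ?thesis by blast
  qed
  show "weak_max_principle_property U ?D ?A ?C"
    unfolding weak_max_principle_property_def
  proof (intro conjI ballI impI)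
    show "openin (top_of_set (frontier U)) ?D" by (simp add: deg_boundary_def)
    show "?C \<subseteq> C2 U" by (auto simp: C2s_def)
    have "(\<lambda>_. 0) \<in> ?C"
      unfolding mem_Collect_eq SUP_ereal_less_PInf_iff
      by (auto simp: zero_mem_C2s usc_envelope_le_0_iff intro: exI[of _ 1])
    then have "?C \<noteq> {}" by blast
    moreover have "(\<lambda>x. u x + v x) \<in> ?C" if "u \<in> ?C" "v \<in> ?C" for u v
      using comb[OF that, of 1 1] by simp
    moreover have "(\<lambda>x. t * u x) \<in> ?C" if "u \<in> ?C" "0 \<le> t" for u t
      using comb[OF that(1) that(1) that(2), of 0] by simp
    ultimately show "function_convex_cone ?C" unfolding function_convex_cone_def by blast
  next
    fix u z
    assume u: "u \<in> ?C"
      and sub: "(\<forall>x\<in>U. ?A u x \<le> 0) \<and> (\<forall>x\<in>frontier U - closure ?D. usc_envelope U u x \<le> 0)"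
      and z: "z \<in> U"
    obtain S where S: "\<forall>x\<in>U. u x \<le> S" using u unfolding SUP_ereal_less_PInf_iff mem_Collect_eq by blast
    have env: "\<forall>x\<in>frontier U - ?D. usc_envelope U u x \<le> 0" using u sub by blast
    show "u z \<le> 0"
    proof (rule ccontr)
      assume "\<not> u z \<le> 0"
      then have "c0 * u z \<le> 0" using bound[of u S 0 z] u S env sub z by simp
      with \<open>\<not> u z \<le> 0\<close> c_lower(1) show False by (simp add: mult_le_0_iff)
    qed
  qed
qed

end
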